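(* Let $\mathcal{X}=\{x\in\mathbb{R}^d: Ax=b,\ x\ge0\}$ be a nonempty bounded nondegenerate polytope with $A\in\mathbb{R}^{m\times d}$ of full row rank, let $\mathcal{C}\subseteq\mathbb{R}^d$ be convex, let $d^\star=\dim\operatorname{dir}(\mathcal{X}^\star(\mathcal{C}))$, and let $P_c$ be a probability distribution supported on $\mathcal{C}$. For any $\delta\in(0,1)$, with probability at least $1-\delta$ over the i.i.d. draw of $c_1,\dots,c_n\sim P_c$, the output $(\mathcal{D}_n,T)$ of the cumulative algorithm (Algorithm 2, described in the context) on $c_1,\dots,c_n$ satisfies $$R(\mathcal{D}_n)\ \le\ \frac{4}{n}\Bigl(6|T|+\ln\frac{e}{\delta}\Bigr)\ \le\ \frac{4}{n}\Bigl(6d^\star+\ln\frac{e}{\delta}\Bigr).$$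
   Context: Nondegenerate: every extreme point of $\mathcal{X}$ has exactly $m$ strictly positive components. $\mathcal{X}^\angle$ is the set of extreme points, $\mathcal{X}^\star(c):=\operatorname{argmin}_{x\in\mathcal{X}}c^\top x$, $\mathcal{X}^\star(\mathcal{C}):=\bigcup_{c\in\mathcal{C}}(\mathcal{X}^\star(c)\cap\mathcal{X}^\angle)$, $\operatorname{dir}(\mathcal{X}^\star(\mathcal{C})):=\operatorname{span}\{x-x':x,x'\in\mathcal{X}^\star(\mathcal{C})\}$. A dataset is a finite set $\mathcal{D}=\{q_1,\dots,q_l\}\subset\mathbb{R}^d$; $s(c;\mathcal{D}):=(q_1^\top c,\dots,q_l^\top c)$; $\mathcal{C}(\mathcal{D},s):=\{c'\in\mathcal{C}: q_i^\top c'=s_i\ \forall i\}$. $\mathcal{D}$ is pointwise sufficient at $c\in\mathcal{C}$ if there is $x^\star\in\mathcal{X}$ with $x^\star\in\mathcal{X}^\star(c')$ for all $c'\in\mathcal{C}(\mathcal{D},s(c;\mathcal{D}))$. The loss is $\ell(\mathcal{D},c):=\mathbf{1}\{\mathcal{D}\text{ is not pointwise sufficient at }c\}$ and the risk is $R(\mathcal{D}):=\mathbb{P}_{c\sim P_c}[\ell(\mathcal{D},c)=1]$. For a basis $B\subseteq\{1,\dots,d\}$, $|B|=m$ ($A_B$ invertible), with complement $N$, $x(B)$ has $x_N(B)=0$, $x_B(B)=A_B^{-1}b$. For $j\in N$, $\delta(B,j)\in\mathbb{R}^d$ has $\delta_N(B,j)=e_j$, $\delta_B(B,j)=-A_B^{-1}A_j$,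 $A_j$ the $j$th column of $A$. Algorithm 1. Input: $(A,b)$, $\mathcal{C}$, $c\in\mathcal{C}$, and an initial finite dataset $\mathcal{D}_{\mathrm{init}}\subset\mathbb{R}^d$. Set $\mathcal{D}\leftarrow\mathcal{D}_{\mathrm{init}}$. Repeat: 1. Let $k=|\mathcal{D}|$, $\mathcal{C}_k:=\mathcal{C}(\mathcal{D},s(c;\mathcal{D}))$, $c^{\mathrm{in}}:=c$. 2. Solve $\min\{(c^{\mathrm{in}})^\top x: x\in\mathcal{X}\}$, obtaining an optimal feasible basis $B$ with nonbasis $N$. 3. For each $j\in N$ let $\delta_j:=\delta(B,j)$, $m_j:=\min_{c'\in\mathcal{C}_k}(c')^\top\delta_j$, and let $c^{\mathrm{out}}_j$ be a minimizer (if the infimum is not attained, $m_j$ is the infimum and, when $m_j<0$, $c_j^{\mathrm{out}}$ is a point of $\mathcal{C}_k$ with $(c_j^{\mathrm{out}})^\top\delta_j<0$). 4. Let $j_0\in\operatorname{argmin}_{j\in N}m_j$, $m_{\min}:=m_{j_0}$, $c^{\mathrm{out}}:=c^{\mathrm{out}}_{j_0}$. 5. If $m_{\min}\ge0$, return $\mathcal{D}$ and stop. 6. Otherwise, for each $j\in N$ with $(c^{\mathrm{out}})^\top\delta_j<0$ set $\alpha_j:=\frac{(c^{\mathrm{in}})^\top\delta_j}{(c^{\mathrm{in}})^\top\delta_j-(c^{\mathrm{out}})^\top\delta_j}\in[0,1)$, pick $j^\star\in\operatorname{argmin}_j\alpha_j$, set $q_{k+1}:=\delta_{j^\star}$ and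 $\mathcal{D}\leftarrow\mathcal{D}\cup\{q_{k+1}\}$. All non-unique choices are resolved by a fixed deterministic rule, so the output is a deterministic function of $(c,\mathcal{D}_{\mathrm{init}})$. Algorithm 2 (cumulative). Input: $\mathcal{C}$, $(A,b)$, samples $c_1,\dots,c_n\in\mathcal{C}$. Set $\mathcal{D}_0=\emptyset$, $T=\emptyset$. For $i=1,\dots,n$: run Algorithm 1 on $c_i$ with $\mathcal{D}_{\mathrm{init}}=\mathcal{D}_{i-1}$, let $\mathcal{D}_i$ be the returned dataset, and if $\mathcal{D}_i\ne\mathcal{D}_{i-1}$ add $i$ to $T$ (such $i$ is called hard). Return $(\mathcal{D}_n,T)$. *)

theory Defs
  imports "HOL-Probability.Probability" "HOL-Library.While_Combinator"
begin

section \<open>The linear program and its optimal vertices\<close>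

definition feasible :: "real^'d^'m \<Rightarrow> real^'m \<Rightarrow> (real^'d) set" where
  "feasible A b = {x. A *v x = b \<and> (\<forall>i. 0 \<le> x $ i)}"

definition vertices :: "(real^'d) set \<Rightarrow> (real^'d) set" where
  "vertices X = {x. x extreme_point_of X}"

definition nondegenerate :: "real^'d^'m \<Rightarrow> real^'m \<Rightarrow> bool" where
  "nondegenerate A b \<longleftrightarrow>
     (\<forall>x \<in> vertices (feasible A b). card {i. 0 < x $ i} = CARD('m))"

definition optimal :: "(real^'d) set \<Rightarrow> real^'d \<Rightarrow> (real^'d) set" where
  "optimal X c = {x \<in> X. \<forall>y \<in> X. c \<bullet> x \<le> c \<bullet> y}"

definition optimal_vertices :: "(real^'d) set \<Rightarrow> (real^'d) set \<Rightarrow> (real^'d) set" where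
  "optimal_vertices X C = (\<Union>c\<in>C. optimal X c \<inter> vertices X)"

definition dir :: "(real^'d) set \<Rightarrow> (real^'d) set" where
  "dir S = span {x - x' | x x'. x \<in> S \<and> x' \<in> S}"


section \<open>Datasets, sufficiency, loss and risk\<close>

text \<open>A vector of observations is a function on the dataset: \<open>s q\<close> is the
  entry of \<open>s\<close> belonging to the query \<open>q\<close>.\<close>

definition observe :: "(real^'d) set \<Rightarrow> real^'d \<Rightarrow> real^'d \<Rightarrow> real" where
  "observe D c = (\<lambda>q\<in>D. q \<bullet> c)"

definition consistent ::
    "(real^'d) set \<Rightarrow> (real^'d) set \<Rightarrow> (real^'d \<Rightarrow> real) \<Rightarrow> (real^'d) set" where
  "consistent C D s = {c' \<in> C. \<forall>q\<in>D. q \<bullet> c' = s q}"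

definition pointwise_sufficient ::
    "(real^'d) set \<Rightarrow> (real^'d) set \<Rightarrow> (real^'d) set \<Rightarrow> real^'d \<Rightarrow> bool" where
  "pointwise_sufficient X C D c \<longleftrightarrow>
     (\<exists>x\<in>X. \<forall>c' \<in> consistent C D (observe D c). x \<in> optimal X c')"

definition loss ::
    "(real^'d) set \<Rightarrow> (real^'d) set \<Rightarrow> (real^'d) set \<Rightarrow> real^'d \<Rightarrow> real" where
  "loss X C D c = of_bool (\<not> pointwise_sufficient X C D c)"

text \<open>Even for Borel \<open>C\<close> the loss event is described by projections of \<open>C\<close> and
  need not be a Borel set; the probability is therefore taken in the completion.\<close>

definition risk ::
    "(real^'d) measure \<Rightarrow> (real^'d) set \<Rightarrow> (real^'d) set \<Rightarrow> (real^'d) set \<Rightarrow> real" where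
  "risk P X C D = \<P>(c in completion P. loss X C D c = 1)"


section \<open>Bases\<close>

text \<open>The columns of \<open>A\<^sub>B\<close> are listed along an arbitrary enumeration of \<open>B\<close> by the
  row index type. Neither invertibility of \<open>A\<^sub>B\<close> nor the zero-padded vector
  \<open>A\<^sub>B\<^sup>-\<^sup>1 y\<close>, which is \<open>basis_solve A B y\<close>, depends on this choice.\<close>

definition basis_enum :: "'d set \<Rightarrow> 'm::finite \<Rightarrow> 'd" where
  "basis_enum B = (SOME e. bij_betw e UNIV B)"

definition basis_matrix :: "real^'d^'m \<Rightarrow> 'd set \<Rightarrow> real^'m^'m" where
  "basis_matrix A B = (\<chi> i k. A $ i $ basis_enum B k)"

definition is_basis :: "real^'d^'m \<Rightarrow> 'd set \<Rightarrow> bool" where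
  "is_basis A B \<longleftrightarrow> card B = CARD('m) \<and> invertible (basis_matrix A B)"

definition basis_solve :: "real^'d^'m \<Rightarrow> 'd set \<Rightarrow> real^'m \<Rightarrow> real^'d" where
  "basis_solve A B y =
     (\<chi> i. if i \<in> B then (matrix_inv (basis_matrix A B) *v y) $ inv (basis_enum B) i else 0)"

definition basic_solution :: "real^'d^'m \<Rightarrow> real^'m \<Rightarrow> 'd set \<Rightarrow> real^'d" where
  "basic_solution A b B = basis_solve A B b"

definition edge_dir :: "real^'d^'m \<Rightarrow> 'd set \<Rightarrow> 'd \<Rightarrow> real^'d" where
  "edge_dir A B j = axis j 1 - basis_solve A B (column j A)"


section \<open>The pointwise algorithm\<close>

text \<open>The choices made in one pass through the loop: the optimal basis \<open>B\<close>, the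
  points \<open>c\<^sup>o\<^sup>u\<^sup>t\<^sub>j\<close>, and the indices \<open>j\<^sub>0\<close> and \<open>j\<^sup>\<star>\<close>.\<close>

record ('d::finite) choice =
  basis :: "'d set"
  c_out :: "'d \<Rightarrow> real^'d"
  j_min :: 'd
  j_star :: 'd

text \<open>\<open>m\<^sub>j\<close> may be \<open>-\<infinity>\<close>.\<close>

definition min_reduced_cost ::
    "real^'d^'m \<Rightarrow> (real^'d) set \<Rightarrow> real^'d \<Rightarrow> (real^'d) set \<Rightarrow> 'd set \<Rightarrow> 'd \<Rightarrow> ereal" where
  "min_reduced_cost A C c D B j =
     (INF c' \<in> consistent C D (observe D c). ereal (c' \<bullet> edge_dir A B j))"

definition ratio :: "real^'d^'m \<Rightarrow> real^'d \<Rightarrow> 'd set \<Rightarrow> real^'d \<Rightarrow> 'd \<Rightarrow> real" where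
  "ratio A c B cout j =
     (c \<bullet> edge_dir A B j) / (c \<bullet> edge_dir A B j - cout \<bullet> edge_dir A B j)"

definition improving :: "real^'d^'m \<Rightarrow> 'd set \<Rightarrow> real^'d \<Rightarrow> 'd set" where
  "improving A B cout = {j. j \<notin> B \<and> cout \<bullet> edge_dir A B j < 0}"

text \<open>If the nonbasis is empty (\<open>m = d\<close>), the infimum is \<open>\<infinity>\<close> and the loop stops.\<close>

definition min_value ::
    "real^'d^'m \<Rightarrow> (real^'d) set \<Rightarrow> real^'d \<Rightarrow> (real^'d) set \<Rightarrow> 'd set \<Rightarrow> ereal" where
  "min_value A C c D B = (INF j \<in> - B. min_reduced_cost A C c D B j)"

definition valid_choice ::
    "real^'d^'m \<Rightarrow> real^'m \<Rightarrow> (real^'d) set \<Rightarrow> real^'d \<Rightarrow> (real^'d) set \<Rightarrow> 'd choice \<Rightarrow> bool" where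
  "valid_choice A b C c D ch \<longleftrightarrow>
    (let B = basis ch;
         Ck = consistent C D (observe D c);
         m = min_reduced_cost A C c D B;
         cout = c_out ch (j_min ch)
     in is_basis A B \<and> basic_solution A b B \<in> optimal (feasible A b) c \<and>
        (\<forall>j\<in>-B.
           if \<exists>c'\<in>Ck. ereal (c' \<bullet> edge_dir A B j) = m j
           then c_out ch j \<in> Ck \<and> ereal (c_out ch j \<bullet> edge_dir A B j) = m j
           else m j < 0 \<longrightarrow> c_out ch j \<in> Ck \<and> c_out ch j \<bullet> edge_dir A B j < 0) \<and>
        (- B \<noteq> {} \<longrightarrow> j_min ch \<in> - B \<and> (\<forall>j\<in>-B. m (j_min ch) \<le> m j)) \<and>
        (min_value A C c D B < 0 \<longrightarrow>
           j_star ch \<in> improving A B cout \<and>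
           (\<forall>j\<in>improving A B cout. ratio A c B cout (j_star ch) \<le> ratio A c B cout j)))"

text \<open>\<open>rule c D\<^sub>i\<^sub>n\<^sub>i\<^sub>t D\<close> resolves the choices in the pass whose current dataset is \<open>D\<close>,
  in the run on \<open>c\<close> started from \<open>D\<^sub>i\<^sub>n\<^sub>i\<^sub>t\<close>. As \<open>D\<close> grows in each pass, this also covers
  rules that look at the previous passes of the same run.\<close>

type_synonym 'd rule = "real^'d \<Rightarrow> (real^'d) set \<Rightarrow> (real^'d) set \<Rightarrow> 'd choice"

definition valid_rule ::
    "real^'d^'m \<Rightarrow> real^'m \<Rightarrow> (real^'d) set \<Rightarrow> 'd rule \<Rightarrow> bool" where
  "valid_rule A b C rule \<longleftrightarrow>
     (\<forall>c\<in>C. \<forall>D\<^sub>i\<^sub>n\<^sub>i\<^sub>t D. finite D\<^sub>i\<^sub>n\<^sub>i\<^sub>t \<longrightarrow> finite D \<longrightarrow>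
        valid_choice A b C c D (rule c D\<^sub>i\<^sub>n\<^sub>i\<^sub>t D))"

text \<open>The value is \<open>None\<close> if the loop does not terminate.\<close>

definition pointwise_alg ::
    "real^'d^'m \<Rightarrow> (real^'d) set \<Rightarrow> 'd rule \<Rightarrow>
     real^'d \<Rightarrow> (real^'d) set \<Rightarrow> (real^'d) set option" where
  "pointwise_alg A C rule c D\<^sub>i\<^sub>n\<^sub>i\<^sub>t =
     while_option
       (\<lambda>D. min_value A C c D (basis (rule c D\<^sub>i\<^sub>n\<^sub>i\<^sub>t D)) < 0)
       (\<lambda>D. D \<union> {edge_dir A (basis (rule c D\<^sub>i\<^sub>n\<^sub>i\<^sub>t D)) (j_star (rule c D\<^sub>i\<^sub>n\<^sub>i\<^sub>t D))})
       D\<^sub>i\<^sub>n\<^sub>i\<^sub>t"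


section \<open>The cumulative algorithm\<close>

text \<open>\<open>cumulative_alg A C rule cs n\<close> is the pair \<open>(D\<^sub>n, T)\<close> obtained from the samples
  \<open>cs 1, \<dots>, cs n\<close>.\<close>

fun cumulative_alg ::
    "real^'d^'m \<Rightarrow> (real^'d) set \<Rightarrow> 'd rule \<Rightarrow>
     (nat \<Rightarrow> real^'d) \<Rightarrow> nat \<Rightarrow> ((real^'d) set \<times> nat set) option" where
  "cumulative_alg A C rule cs 0 = Some ({}, {})"
| "cumulative_alg A C rule cs (Suc i) =
     (case cumulative_alg A C rule cs i of
        None \<Rightarrow> None
      | Some (D, T) \<Rightarrow>
          (case pointwise_alg A C rule (cs (Suc i)) D of
             None \<Rightarrow> None
           | Some D' \<Rightarrow> Some (D', if D' \<noteq> D then insert (Suc i) T else T)))"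

end

theory Submission
  imports Defs
begin

text \<open>Write \<open>\<ell>(D)\<close> for the set of costs at which the dataset \<open>D\<close> is not
  pointwise sufficient, and call a sample hard if it enlarges the current dataset. Three facts
  about the pointwise algorithm carry the proof.

  (1) It stops only at a basis that is optimal for every cost consistent with the dataset, so a
  sample in \<open>\<ell>(D)\<close> is hard for \<open>D\<close>.

  (2) Each new query \<open>q\<close> separates the true cost from a cost with the same observations, so
  \<open>q\<close> is not in the span of the earlier queries. It is also an edge along which the cost on the
  segment between the two, at the first breakpoint, is constant; by nondegeneracy this edge has
  positive length inside the polytope, so it lies in the direction space of the optimal vertices.
  Datasets therefore stay independent in a space of dimension \<open>d\<^sup>\<star>\<close>: the algorithm
  terminates and there are at most \<open>d\<^sup>\<star>\<close> hard samples (\<open>pointwise_alg_correct\<close>).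

  (3) Adding queries shrinks \<open>\<ell>\<close>. If the final dataset has risk above \<open>\<epsilon>\<close>, then
  \<open>\<ell>\<close> of every earlier one contains an event of probability above \<open>\<epsilon>\<close>, and by (1)
  each sample was hard with conditional probability above \<open>\<epsilon>\<close>.

  By (3), a final risk above \<open>\<epsilon>\<close> together with few hard samples is as unlikely as few
  successes in \<open>n\<close> trials of success probability \<open>\<epsilon>\<close>. Concretely,
  \<open>exp (-|T|)\<close>, restricted to the datasets contained in one of risk above \<open>\<epsilon>\<close>,
  shrinks by the factor \<open>exp (-\<epsilon> (1 - 1/e))\<close> in expectation with every sample
  (\<open>hard_rounds_exp_moment\<close>), and Markov's inequality gives
  \<open>P(|T| = k, risk > \<epsilon>) \<le> exp (k - n \<epsilon> (1 - 1/e))\<close>. For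
  \<open>\<epsilon> = 4/n (6 k + ln (e/\<delta>))\<close> this is at most \<open>\<delta> / 2\<^sup>k\<^sup>+\<^sup>1\<close>, and a union
  bound over \<open>k\<close> finishes the argument (\<open>hard_rounds_risk_bound\<close>). Monotonicity replaces
  the usual sample compression argument: no union over subsets of the sample is taken.

  The transition events belong only to the completion of \<open>P\<close>. As the datasets come from a
  finite family, one null set can be removed so that all transitions become Borel.\<close>

section \<open>Bases and edge directions\<close>

lemma basis_enum_bij:
  fixes B :: "'d::finite set"
  assumes "card B = CARD('m)"
  shows "bij_betw (basis_enum B :: 'm::finite \<Rightarrow> 'd) UNIV B"
proof -
  have "\<exists>e :: 'm \<Rightarrow> 'd. bij_betw e UNIV B"
    by (rule finite_same_card_bij) (use assms in auto)
  then show ?thesis unfolding basis_enum_def by (rule someI_ex)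
qed

lemma matrix_times_supported:
  fixes A :: "real^'d^'m"
  assumes "card B = CARD('m)" and "\<And>i. i \<notin> B \<Longrightarrow> z $ i = 0"
  shows "A *v z = basis_matrix A B *v (\<chi> k. z $ basis_enum B k)"
proof -
  have "(\<Sum>j\<in>UNIV. A $ i $ j * z $ j) = (\<Sum>k\<in>(UNIV::'m set). A $ i $ basis_enum B k * z $ basis_enum B k)"
    for i
  proof -
    have "(\<Sum>j\<in>UNIV. A $ i $ j * z $ j) = (\<Sum>j\<in>B. A $ i $ j * z $ j)"
      by (rule sum.mono_neutral_right) (auto simp: assms(2))
    also have "\<dots> = (\<Sum>k\<in>(UNIV::'m set). A $ i $ basis_enum B k * z $ basis_enum B k)"
      by (rule sum.reindex_bij_betw[symmetric]) (rule basis_enum_bij[OF assms(1)])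
    finally show ?thesis .
  qed
  then show ?thesis
    by (simp add: vec_eq_iff matrix_vector_mult_def basis_matrix_def)
qed

lemma matrix_inv_invertible:
  fixes M :: "real^'n^'n"
  assumes "invertible M"
  shows "M ** matrix_inv M = mat 1" "matrix_inv M ** M = mat 1"
  using assms unfolding invertible_def matrix_inv_def by (metis (mono_tags, lifting) someI_ex)+

lemma basis_solve_outside: "i \<notin> B \<Longrightarrow> basis_solve A B y $ i = 0"
  by (simp add: basis_solve_def)

lemma matrix_times_basis_solve:
  fixes A :: "real^'d^'m"
  assumes "is_basis A B"
  shows "A *v basis_solve A B y = y"
proof -
  have card: "card B = CARD('m)" and inv: "invertible (basis_matrix A B)"
    using assms by (auto simp: is_basis_def)
  have bij: "bij_betw (basis_enum B :: 'm \<Rightarrow> 'd) UNIV B"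
    using card by (rule basis_enum_bij)
  have "(\<chi> k. basis_solve A B y $ basis_enum B k) = matrix_inv (basis_matrix A B) *v y"
    using bij by (auto simp: vec_eq_iff basis_solve_def bij_betw_def)
  then have "A *v basis_solve A B y
      = basis_matrix A B *v (matrix_inv (basis_matrix A B) *v y)"
    using matrix_times_supported[OF card, of "basis_solve A B y" A]
    by (simp add: basis_solve_outside)
  also have "\<dots> = y"
    by (simp add: matrix_vector_mul_assoc matrix_inv_invertible inv)
  finally show ?thesis .
qed

lemma kernel_supported_on_basis:
  fixes A :: "real^'d^'m"
  assumes "is_basis A B" "A *v z = 0" "\<And>i. i \<notin> B \<Longrightarrow> z $ i = 0"
  shows "z = 0"
proof -
  have card: "card B = CARD('m)" and inv: "invertible (basis_matrix A B)"
    using assms by (auto simp: is_basis_def)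
  let ?w = "(\<chi> k. z $ basis_enum B k) :: real^'m"
  have "basis_matrix A B *v ?w = 0"
    using matrix_times_supported[OF card, of z A] assms by simp
  then have "matrix_inv (basis_matrix A B) *v (basis_matrix A B *v ?w) = 0"
    by simp
  then have w: "?w = 0"
    by (simp add: matrix_vector_mul_assoc matrix_inv_invertible inv)
  have "z $ i = 0" for i
  proof (cases "i \<in> B")
    case True
    then obtain k :: 'm where "i = basis_enum B k"
      using basis_enum_bij[OF card] by (auto simp: bij_betw_def)
    then show ?thesis using w by (simp add: vec_eq_iff)
  qed (use assms in auto)
  then show ?thesis by (simp add: vec_eq_iff)
qed

lemma matrix_times_edge_dir:
  "is_basis A B \<Longrightarrow> A *v edge_dir A B j = 0"
  by (simp add: edge_dir_def matrix_vector_mult_diff_distrib matrix_times_basis_solve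
      matrix_vector_mult_basis)

lemma edge_dir_outside:
  "i \<notin> B \<Longrightarrow> edge_dir A B j $ i = (if i = j then 1 else 0)"
  by (simp add: edge_dir_def basis_solve_outside axis_def)

text \<open>A kernel vector is determined by its nonbasic coordinates, and edge directions
  realise the unit vectors there. Hence the differences of feasible points are combinations of
  edge directions, and reduced costs decide optimality.\<close>

lemma kernel_edge_expansion:
  fixes A :: "real^'d^'m"
  assumes "is_basis A B" "A *v z = 0"
  shows "z = (\<Sum>j\<in>-B. z $ j *\<^sub>R edge_dir A B j)"
proof -
  let ?s = "\<Sum>j\<in>-B. z $ j *\<^sub>R edge_dir A B j"
  have "A *v ?s = (\<Sum>j\<in>-B. z $ j *\<^sub>R (A *v edge_dir A B j))"
    by (simp add: linear_sum[OF matrix_vector_mul_linear] matrix_vector_mult_scaleR)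
  then have ker: "A *v (z - ?s) = 0"
    using assms by (simp add: matrix_vector_mult_diff_distrib matrix_times_edge_dir)
  have "(z - ?s) $ i = 0" if "i \<notin> B" for i
    using that by (simp add: edge_dir_outside if_distrib cong: if_cong)
  then have "z - ?s = 0"
    using kernel_supported_on_basis[OF assms(1) ker] by blast
  then show ?thesis by simp
qed

section \<open>Optimality of basic solutions\<close>

lemma basic_solution_optimal_if:
  fixes A :: "real^'d^'m"
  assumes "is_basis A B" "basic_solution A b B \<in> feasible A b"
    and "\<And>j. j \<notin> B \<Longrightarrow> 0 \<le> c \<bullet> edge_dir A B j"
  shows "basic_solution A b B \<in> optimal (feasible A b) c"
proof -
  let ?x = "basic_solution A b B"
  have "c \<bullet> ?x \<le> c \<bullet> y" if y: "y \<in> feasible A b" for y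
  proof -
    have "A *v (y - ?x) = 0"
      using y assms(2) by (simp add: feasible_def matrix_vector_mult_diff_distrib)
    then have "y - ?x = (\<Sum>j\<in>-B. (y - ?x) $ j *\<^sub>R edge_dir A B j)"
      by (rule kernel_edge_expansion[OF assms(1)])
    also have "\<dots> = (\<Sum>j\<in>-B. y $ j *\<^sub>R edge_dir A B j)"
      by (intro sum.cong) (auto simp: basic_solution_def basis_solve_outside)
    finally have "c \<bullet> (y - ?x) = (\<Sum>j\<in>-B. y $ j * (c \<bullet> edge_dir A B j))"
      by (simp add: inner_sum_right)
    also have "\<dots> \<ge> 0"
      using y assms(3) by (intro sum_nonneg) (auto simp: feasible_def)
    finally show ?thesis by (simp add: inner_diff_right)
  qed
  then show ?thesis using assms(2) by (simp add: optimal_def)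
qed

text \<open>Nonnegative summands of a zero coordinate vanish, so the ends of a segment
  through a basic solution agree with it off the basis, hence everywhere. The lemma makes
  nondegeneracy, a condition on vertices, applicable to bases.\<close>

lemma basic_solution_vertex:
  fixes A :: "real^'d^'m"
  assumes "is_basis A B" "basic_solution A b B \<in> feasible A b"
  shows "basic_solution A b B \<in> vertices (feasible A b)"
proof -
  let ?x = "basic_solution A b B"
  have "False" if u: "u \<in> feasible A b" and v: "v \<in> feasible A b"
    and x: "?x \<in> open_segment u v" for u v
  proof -
    obtain t where t: "0 < t" "t < 1" and xt: "?x = (1 - t) *\<^sub>R u + t *\<^sub>R v" and "u \<noteq> v"
      using x by (auto simp: in_segment)
    have "u $ i = 0 \<and> v $ i = 0" if "i \<notin> B" for i
    proof -
      have "(1 - t) * u $ i + t * v $ i = ?x $ i" by (simp add: xt)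
      also have "\<dots> = 0" using that by (simp add: basic_solution_def basis_solve_outside)
      finally have "(1 - t) * u $ i = 0 \<and> t * v $ i = 0"
        using t u v by (subst (asm) add_nonneg_eq_0_iff) (auto simp: feasible_def)
      then show ?thesis using t by simp
    qed
    moreover have "A *v (u - v) = 0"
      using u v by (simp add: feasible_def matrix_vector_mult_diff_distrib)
    ultimately have "u - v = 0"
      by (intro kernel_supported_on_basis[OF assms(1)]) auto
    with \<open>u \<noteq> v\<close> show False by simp
  qed
  then show ?thesis using assms(2) by (auto simp: vertices_def extreme_point_of_def)
qed

lemma basic_solution_pos:
  fixes A :: "real^'d^'m"
  assumes "nondegenerate A b" "is_basis A B" "basic_solution A b B \<in> feasible A b" "i \<in> B"
  shows "0 < basic_solution A b B $ i"
proof -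
  let ?S = "{i. 0 < basic_solution A b B $ i}"
  have "card ?S = card B"
    using assms basic_solution_vertex by (auto simp: nondegenerate_def is_basis_def)
  moreover have "?S \<subseteq> B"
    by (auto simp: basic_solution_def basis_solve_def split: if_splits)
  ultimately have "?S = B" by (simp add: card_subset_eq)
  with assms(4) show ?thesis by blast
qed

text \<open>Nondegeneracy leaves slack in every basic coordinate, so the edge has positive
  length.\<close>

lemma feasible_edge_step:
  fixes A :: "real^'d^'m"
  assumes "nondegenerate A b" "is_basis A B" "basic_solution A b B \<in> feasible A b" "j \<notin> B"
  obtains t where "0 < t" "basic_solution A b B + t *\<^sub>R edge_dir A B j \<in> feasible A b"
proof -
  let ?x = "basic_solution A b B" and ?\<delta> = "edge_dir A B j"
  have "\<exists>t>0. \<forall>s\<in>{0..t}. 0 \<le> ?x $ i + s * ?\<delta> $ i" for i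
  proof (cases "i \<in> B")
    case True
    then have p: "0 < ?x $ i" by (rule basic_solution_pos[OF assms(1-3)])
    define t where "t = ?x $ i / (\<bar>?\<delta> $ i\<bar> + 1)"
    have "0 < t" using p by (simp add: t_def)
    moreover have "0 \<le> ?x $ i + s * ?\<delta> $ i" if "s \<in> {0..t}" for s
    proof -
      have "\<bar>s * ?\<delta> $ i\<bar> \<le> t * (\<bar>?\<delta> $ i\<bar> + 1)"
        using that by (auto simp: abs_mult intro!: mult_mono)
      also have "\<dots> = ?x $ i" by (simp add: t_def add_nonneg_eq_0_iff)
      finally show ?thesis by linarith
    qed
    ultimately show ?thesis by blast
  next
    case False
    then show ?thesis
      by (intro exI[of _ 1]) (auto simp: edge_dir_outside basic_solution_def basis_solve_outside)
  qed
  then obtain t where t: "\<And>i. 0 < t i"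
      "\<And>i s. s \<in> {0..t i} \<Longrightarrow> 0 \<le> ?x $ i + s * ?\<delta> $ i"
    by metis
  define u where "u = Min (range t)"
  have "0 < u" using t(1) by (simp add: u_def)
  moreover have "u \<le> t i" for i by (simp add: u_def)
  ultimately have "0 \<le> ?x $ i + u * ?\<delta> $ i" for i by (intro t(2)) auto
  moreover have "A *v (?x + u *\<^sub>R ?\<delta>) = b"
    using assms by (simp add: matrix_vector_right_distrib matrix_vector_mult_scaleR
        matrix_times_edge_dir feasible_def)
  ultimately show thesis using \<open>0 < u\<close> by (intro that[of u]) (auto simp: feasible_def)
qed

lemma reduced_cost_nonneg:
  fixes A :: "real^'d^'m"
  assumes "nondegenerate A b" "is_basis A B" "basic_solution A b B \<in> optimal (feasible A b) c"
    "j \<notin> B"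
  shows "0 \<le> c \<bullet> edge_dir A B j"
proof -
  have "basic_solution A b B \<in> feasible A b" using assms(3) by (simp add: optimal_def)
  then obtain t where t: "0 < t" "basic_solution A b B + t *\<^sub>R edge_dir A B j \<in> feasible A b"
    using feasible_edge_step assms by blast
  then have "c \<bullet> basic_solution A b B \<le> c \<bullet> (basic_solution A b B + t *\<^sub>R edge_dir A B j)"
    using assms(3) unfolding optimal_def by blast
  then show ?thesis using t(1) by (simp add: inner_add_right zero_le_mult_iff)
qed

section \<open>Edges inside an optimal face\<close>

lemma compact_feasible:
  fixes A :: "real^'d^'m"
  assumes "bounded (feasible A b)"
  shows "compact (feasible A b)"
proof -
  have "feasible A b = ((\<lambda>x. A *v x) -` {b}) \<inter> {x. \<forall>i. 0 \<le> x $ i}"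
    by (auto simp: feasible_def)
  moreover have "closed ((\<lambda>x. A *v x) -` {b})"
    by (intro closed_vimage) (auto intro!: linear_continuous_on matrix_vector_mul_bounded_linear)
  moreover have "closed {x::real^'d. \<forall>i. 0 \<le> x $ i}"
    by (intro closed_Collect_all closed_Collect_le continuous_intros)
  ultimately show ?thesis using assms by (simp add: compact_eq_bounded_closed closed_Int)
qed

lemma convex_feasible: "convex (feasible A b)"
  unfolding convex_alt feasible_def
  by (auto simp: matrix_vector_right_distrib matrix_vector_mult_scaleR simp flip: scaleR_left_distrib)

lemma optimal_face_of:
  fixes X :: "(real^'d) set"
  assumes "convex X"
  shows "optimal X c face_of X"
proof (cases "optimal X c = {}")
  case False
  then obtain x where x: "x \<in> X" "\<And>y. y \<in> X \<Longrightarrow> c \<bullet> x \<le> c \<bullet> y"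
    by (auto simp: optimal_def)
  have "optimal X c = X \<inter> {y. c \<bullet> y = c \<bullet> x}"
    using x by (auto simp: optimal_def intro: antisym)
  then show ?thesis
    using face_of_Int_supporting_hyperplane_ge[OF assms, of "c \<bullet> x" c] x by auto
qed auto

text \<open>By Krein-Milman an optimal face is the hull of the optimal vertices. With this, any
  short step along an edge inside the face shows the edge direction to be in the direction space;
  the adjacent vertex at its far end need not be constructed.\<close>

lemma optimal_subset_hull:
  assumes "compact X" "convex X"
  shows "optimal X c \<subseteq> convex hull (optimal X c \<inter> vertices X)"
proof -
  have F: "optimal X c face_of X" by (rule optimal_face_of[OF assms(2)])
  have "compact (optimal X c)" "convex (optimal X c)"
    using F assms face_of_imp_compact face_of_imp_convex by blast+
  then have "optimal X c = convex hull {x. x extreme_point_of optimal X c}"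
    by (rule Krein_Milman_Minkowski)
  also have "{x. x extreme_point_of optimal X c} = optimal X c \<inter> vertices X"
    using extreme_point_of_face[OF F] by (auto simp: vertices_def)
  finally show ?thesis by simp
qed

lemma diff_in_dir:
  assumes "x \<in> convex hull V" "y \<in> convex hull V"
  shows "x - y \<in> dir V"
proof -
  obtain v where v: "v \<in> V" using assms(1) by fastforce
  have *: "z - v \<in> dir V" if "z \<in> convex hull V" for z
  proof -
    have "V \<subseteq> (\<lambda>w. v + w) ` dir V"
    proof
      fix u assume "u \<in> V"
      then have "u - v \<in> dir V" unfolding dir_def using v by (intro span_base) blast
      then show "u \<in> (\<lambda>w. v + w) ` dir V" by (intro image_eqI[of _ _ "u - v"]) auto
    qed
    moreover have "convex ((\<lambda>w. v + w) ` dir V)"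
      by (intro convex_translation subspace_imp_convex) (simp add: dir_def)
    ultimately have "convex hull V \<subseteq> (\<lambda>w. v + w) ` dir V" by (rule hull_minimal)
    with that show ?thesis by auto
  qed
  have "(x - v) - (y - v) \<in> dir V"
    using *[OF assms(1)] *[OF assms(2)] unfolding dir_def by (rule span_diff)
  then show ?thesis by simp
qed

lemma edge_dir_in_dir:
  fixes A :: "real^'d^'m"
  assumes "bounded (feasible A b)" "nondegenerate A b"
    and "is_basis A B" "basic_solution A b B \<in> optimal (feasible A b) c" "c \<in> C"
    and "j \<notin> B" "c \<bullet> edge_dir A B j = 0"
  shows "edge_dir A B j \<in> dir (optimal_vertices (feasible A b) C)"
proof -
  let ?X = "feasible A b" and ?x = "basic_solution A b B" and ?\<delta> = "edge_dir A B j"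
  let ?V = "optimal_vertices ?X C"
  have "?x \<in> ?X" using assms(4) by (simp add: optimal_def)
  then obtain t where t: "0 < t" "?x + t *\<^sub>R ?\<delta> \<in> ?X"
    using feasible_edge_step assms by blast
  have opt: "?x + t *\<^sub>R ?\<delta> \<in> optimal ?X c"
    using t assms(4,7) by (simp add: optimal_def inner_add_right)
  have "optimal ?X c \<subseteq> convex hull (optimal ?X c \<inter> vertices ?X)"
    by (intro optimal_subset_hull compact_feasible convex_feasible assms)
  also have "\<dots> \<subseteq> convex hull ?V"
    using assms(5) by (intro hull_mono) (auto simp: optimal_vertices_def)
  finally have "(?x + t *\<^sub>R ?\<delta>) - ?x \<in> dir ?V"
    using opt assms(4) by (intro diff_in_dir) auto
  then have "inverse t *\<^sub>R ((?x + t *\<^sub>R ?\<delta>) - ?x) \<in> dir ?V"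
    unfolding dir_def by (rule span_scale)
  moreover have "inverse t *\<^sub>R ((?x + t *\<^sub>R ?\<delta>) - ?x) = ?\<delta>" using t(1) by simp
  ultimately show ?thesis by metis
qed

section \<open>The queries of the pointwise algorithm\<close>

text \<open>Moving from \<open>c\<close> to \<open>c\<^sup>o\<^sup>u\<^sup>t\<close>, the basis stays optimal until the smallest
  ratio \<open>\<alpha>\<close> is reached. There the reduced cost of the selected edge is zero, so the edge lies
  in an optimal face of a cost in \<open>C\<close>. The edge is not in \<open>span D\<close> since the two costs agree
  on \<open>D\<close> but differ in sign on the edge.\<close>

lemma
  fixes A :: "real^'d^'m"
  assumes "bounded (feasible A b)" "nondegenerate A b" "convex C" "c \<in> C"
    and valid: "valid_choice A b C c D ch" and neg: "min_value A C c D (basis ch) < 0"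
  defines "q \<equiv> edge_dir A (basis ch) (j_star ch)"
  shows selected_query_in_dir: "q \<in> dir (optimal_vertices (feasible A b) C)"
    and selected_query_notin_span: "q \<notin> span D"
proof -
  let ?X = "feasible A b" and ?B = "basis ch" and ?Ck = "consistent C D (observe D c)"
  let ?m = "min_reduced_cost A C c D ?B" and ?r = "\<lambda>u j. u \<bullet> edge_dir A ?B j"
  define cout where "cout = c_out ch (j_min ch)"
  have B: "is_basis A ?B" and x: "basic_solution A b ?B \<in> optimal ?X c"
    using valid by (auto simp: valid_choice_def Let_def)
  obtain j where j: "j \<in> - ?B" "?m j < 0"
    using neg by (auto simp: min_value_def INF_less_iff)
  have jmin: "j_min ch \<in> - ?B" "?m (j_min ch) \<le> ?m j"
    using valid j by (auto simp: valid_choice_def Let_def)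
  then have m: "?m (j_min ch) < 0" using j by simp
  \<comment> \<open>A negative infimum yields a consistent \<open>c\<^sup>o\<^sup>u\<^sup>t\<close> whether or not it is attained.\<close>
  have cout: "cout \<in> ?Ck"
    using valid jmin m unfolding valid_choice_def Let_def cout_def by (meson)
  have js: "j_star ch \<in> improving A ?B cout"
      "\<And>i. i \<in> improving A ?B cout \<Longrightarrow> ratio A c ?B cout (j_star ch) \<le> ratio A c ?B cout i"
    using valid neg by (auto simp: valid_choice_def Let_def cout_def)
  have jsN: "j_star ch \<notin> ?B" and out_neg: "?r cout (j_star ch) < 0"
    using js(1) by (auto simp: improving_def)
  have in_nonneg: "0 \<le> ?r c i" if "i \<notin> ?B" for i
    using reduced_cost_nonneg[OF assms(2) B x that] .
  show "q \<notin> span D"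
  proof
    assume "q \<in> span D"
    moreover have "d \<bullet> (cout - c) = 0" if "d \<in> D" for d
      using that cout by (simp add: consistent_def observe_def inner_diff_right)
    ultimately have "q \<bullet> (cout - c) = 0"
      by (induction rule: span_induct_alt) (auto simp: inner_add_left)
    then have "cout \<bullet> q = c \<bullet> q" by (simp add: inner_diff_right inner_commute)
    with out_neg in_nonneg[OF jsN] show False by (simp add: q_def)
  qed
  define \<alpha> where "\<alpha> = ratio A c ?B cout (j_star ch)"
  have \<alpha>: "0 \<le> \<alpha>" "\<alpha> \<le> 1"
    using in_nonneg[OF jsN] out_neg by (auto simp: \<alpha>_def ratio_def divide_simps)
  define c\<alpha> where "c\<alpha> = (1 - \<alpha>) *\<^sub>R c + \<alpha> *\<^sub>R cout"
  have "c\<alpha> \<in> C"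
    using \<alpha> cout assms(3,4) by (auto simp: c\<alpha>_def consistent_def convex_alt)
  have r: "?r c\<alpha> i = ?r c i - \<alpha> * (?r c i - ?r cout i)" for i
    by (simp add: c\<alpha>_def inner_add_left algebra_simps)
  have zero: "?r c\<alpha> (j_star ch) = 0"
    using in_nonneg[OF jsN] out_neg by (simp add: r \<alpha>_def ratio_def)
  have nonneg: "0 \<le> ?r c\<alpha> i" if i: "i \<notin> ?B" for i
  proof (cases "?r cout i < 0")
    case True
    then have "\<alpha> \<le> ratio A c ?B cout i"
      using i js(2) by (auto simp: \<alpha>_def improving_def)
    then have "\<alpha> * (?r c i - ?r cout i) \<le> ?r c i"
      using True in_nonneg[OF i] by (simp add: ratio_def pos_le_divide_eq)
    then show ?thesis by (simp add: r)
  next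
    case False
    then show ?thesis using in_nonneg[OF i] \<alpha> by (simp add: c\<alpha>_def inner_add_left)
  qed
  have "basic_solution A b ?B \<in> optimal ?X c\<alpha>"
    using B x nonneg by (intro basic_solution_optimal_if) (auto simp: optimal_def)
  then show "q \<in> dir (optimal_vertices ?X C)"
    unfolding q_def using B jsN zero \<open>c\<alpha> \<in> C\<close> assms(1,2) by (intro edge_dir_in_dir)
qed

lemma pointwise_sufficient_if_min_value:
  fixes A :: "real^'d^'m"
  assumes valid: "valid_choice A b C c D ch" and "\<not> min_value A C c D (basis ch) < 0"
  shows "pointwise_sufficient (feasible A b) C D c"
proof -
  let ?B = "basis ch"
  have B: "is_basis A ?B" and x: "basic_solution A b ?B \<in> optimal (feasible A b) c"
    using valid by (auto simp: valid_choice_def Let_def)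
  have "basic_solution A b ?B \<in> optimal (feasible A b) c'"
    if c': "c' \<in> consistent C D (observe D c)" for c'
  proof (rule basic_solution_optimal_if[OF B])
    show "basic_solution A b ?B \<in> feasible A b" using x by (simp add: optimal_def)
    fix j assume "j \<notin> ?B"
    then have "0 \<le> min_reduced_cost A C c D ?B j"
      using assms(2) unfolding min_value_def not_less by (meson ComplI INF_lower order_trans)
    also have "\<dots> \<le> ereal (c' \<bullet> edge_dir A ?B j)"
      unfolding min_reduced_cost_def using c' by (intro INF_lower)
    finally show "0 \<le> c' \<bullet> edge_dir A ?B j" by simp
  qed
  then show ?thesis using x by (auto simp: pointwise_sufficient_def optimal_def)
qed

lemma pointwise_sufficient_mono:
  assumes "D \<subseteq> D'" "pointwise_sufficient X C D c"
  shows "pointwise_sufficient X C D' c"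
proof -
  have "consistent C D' (observe D' c) \<subseteq> consistent C D (observe D c)"
    using assms(1) by (auto simp: consistent_def observe_def)
  then show ?thesis using assms(2) by (auto simp: pointwise_sufficient_def)
qed

definition edge_dirs :: "real^'d^'m \<Rightarrow> (real^'d) set" where
  "edge_dirs A = range (\<lambda>(B, j). edge_dir A B j)"

lemma finite_edge_dirs: "finite (edge_dirs A)"
  by (simp add: edge_dirs_def)

text \<open>The family is finite, which makes the state space of the cumulative algorithm
  discrete, and its independence condition bounds the number of hard samples.\<close>

definition query_datasets :: "real^'d^'m \<Rightarrow> real^'m \<Rightarrow> (real^'d) set \<Rightarrow> (real^'d) set set" where
  "query_datasets A b C =
     {D. D \<subseteq> edge_dirs A \<inter> dir (optimal_vertices (feasible A b) C) \<and> independent D}"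

lemma finite_query_datasets: "finite (query_datasets A b C)"
  by (rule finite_subset[of _ "Pow (edge_dirs A)"])
    (auto simp: query_datasets_def finite_edge_dirs)

lemma query_dataset_finite: "D \<in> query_datasets A b C \<Longrightarrow> finite D"
  by (auto simp: query_datasets_def finite_edge_dirs intro: finite_subset)

lemma query_dataset_card:
  assumes "D \<in> query_datasets A b C"
  shows "card D \<le> dim (dir (optimal_vertices (feasible A b) C))"
  using assms by (intro independent_card_le_dim) (auto simp: query_datasets_def)

text \<open>Each pass adds an independent query from a space of dimension \<open>d\<^sup>\<star>\<close>, which
  bounds the number of passes.\<close>

lemma pointwise_alg_correct:
  fixes A :: "real^'d^'m"
  assumes "bounded (feasible A b)" "nondegenerate A b" "convex C" "c \<in> C"
    and rule: "valid_rule A b C rule" and D: "D \<in> query_datasets A b C"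
  shows "\<exists>D'. pointwise_alg A C rule c D = Some D' \<and> D \<subseteq> D' \<and> D' \<in> query_datasets A b C
           \<and> pointwise_sufficient (feasible A b) C D' c"
proof -
  let ?b = "\<lambda>E. min_value A C c E (basis (rule c D E)) < 0"
  let ?q = "\<lambda>E. edge_dir A (basis (rule c D E)) (j_star (rule c D E))"
  let ?f = "\<lambda>E. E \<union> {?q E}"
  let ?P = "\<lambda>E. D \<subseteq> E \<and> E \<in> query_datasets A b C"
  have valid: "valid_choice A b C c E (rule c D E)" if "?P E" for E
    using rule \<open>c \<in> C\<close> query_dataset_finite[OF D] query_dataset_finite[of E A b C] that
    by (simp add: valid_rule_def)
  have step: "?P (?f E) \<and> card (?f E) = Suc (card E)" if "?P E" "?b E" for E
  proof -
    have q: "?q E \<in> dir (optimal_vertices (feasible A b) C)" "?q E \<notin> span E"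
      using selected_query_in_dir[OF assms(1-4) valid[OF that(1)] that(2)]
        selected_query_notin_span[OF assms(1-4) valid[OF that(1)] that(2)] .
    have "?q E \<in> edge_dirs A" by (auto simp: edge_dirs_def)
    moreover have "?q E \<notin> E" using q(2) by (auto dest: span_base)
    moreover have "finite E" using that(1) query_dataset_finite by blast
    ultimately show ?thesis
      using that(1) q
      by (auto simp: query_datasets_def independent_insertI)
  qed
  have "\<exists>D'. while_option ?b ?f D = Some D'"
  proof (rule measure_while_option_Some[where P = ?P
        and f = "\<lambda>E. dim (dir (optimal_vertices (feasible A b) C)) - card E"])
    show "?P D" using D by simp
  next
    fix E assume "?P E" "?b E"
    then have "?P (?f E)" "card (?f E) = Suc (card E)" using step by blast+
    then show "?P (?f E) \<and> dim (dir (optimal_vertices (feasible A b) C)) - card (?f E)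
        < dim (dir (optimal_vertices (feasible A b) C)) - card E"
      using query_dataset_card[of "?f E" A b C] by auto
  qed
  then obtain D' where D': "while_option ?b ?f D = Some D'" by blast
  have P: "?P D'"
    by (rule while_option_rule[OF _ D', where P = ?P]) (use step D in auto)
  moreover have "\<not> ?b D'" using while_option_stop[OF D'] .
  ultimately have "pointwise_sufficient (feasible A b) C D' c"
    using pointwise_sufficient_if_min_value[OF valid] by blast
  then show ?thesis using D' P by (auto simp: pointwise_alg_def)
qed


section \<open>Learners whose state only grows\<close>

text \<open>The cumulative algorithm in the abstract: its state is the current dataset, ordered by
  inclusion. As in the algorithm, the samples are numbered from 1.\<close>

fun state_after :: "('s \<Rightarrow> 'a \<Rightarrow> 's) \<Rightarrow> 's \<Rightarrow> (nat \<Rightarrow> 'a) \<Rightarrow> nat \<Rightarrow> 's" where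
  "state_after g s0 cs 0 = s0"
| "state_after g s0 cs (Suc i) = g (state_after g s0 cs i) (cs (Suc i))"

fun hard_rounds :: "('s \<Rightarrow> 'a \<Rightarrow> 's) \<Rightarrow> 's \<Rightarrow> (nat \<Rightarrow> 'a) \<Rightarrow> nat \<Rightarrow> nat set" where
  "hard_rounds g s0 cs 0 = {}"
| "hard_rounds g s0 cs (Suc i) = 
    (if state_after g s0 cs (Suc i) \<noteq> state_after g s0 cs i then insert (Suc i) (hard_rounds g s0 cs i) else hard_rounds g s0 cs i)"

lemma hard_rounds_subset: "hard_rounds g s0 cs i \<subseteq> {1..i}"
  by (induction i) auto

lemma finite_hard_rounds: "finite (hard_rounds g s0 cs i)"
  by (rule finite_subset[OF hard_rounds_subset]) simp

lemma card_hard_rounds_Suc: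
  "card (hard_rounds g s0 cs (Suc i)) =
     card (hard_rounds g s0 cs i) + of_bool (state_after g s0 cs (Suc i) \<noteq> state_after g s0 cs i)"
proof -
  have "Suc i \<notin> hard_rounds g s0 cs i"
  proof
    assume "Suc i \<in> hard_rounds g s0 cs i"
    then have "Suc i \<in> {1..i}" by (rule subsetD[OF hard_rounds_subset])
    then show False by simp
  qed
  then show ?thesis by (simp add: finite_hard_rounds)
qed

lemma state_after_cong: "(\<And>j. j \<in> {1..i} \<Longrightarrow> cs j = cs' j) \<Longrightarrow> state_after g s0 cs i = state_after g s0 cs' i"
proof (induction i)
  case (Suc i)
  have "state_after g s0 cs i = state_after g s0 cs' i"
    by (rule Suc.IH) (rule Suc.prems, simp)
  moreover have "cs (Suc i) = cs' (Suc i)" by (rule Suc.prems) simp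
  ultimately show ?case by simp
qed simp

lemma hard_rounds_cong: 
  assumes "\<And>j. j \<in> {1..i} \<Longrightarrow> cs j = cs' j"
  shows "hard_rounds g s0 cs i = hard_rounds g s0 cs' i"
  using assms
proof (induction i)
  case (Suc i)
  have "hard_rounds g s0 cs i = hard_rounds g s0 cs' i"
    by (rule Suc.IH) (rule Suc.prems, simp)
  moreover have "state_after g s0 cs i = state_after g s0 cs' i"
    by (rule state_after_cong) (rule Suc.prems, simp)
  moreover have "state_after g s0 cs (Suc i) = state_after g s0 cs' (Suc i)"
    by (rule state_after_cong) (rule Suc.prems)
  ultimately show ?case by (simp only: hard_rounds.simps)
qed simp

locale growing_learner = prob_space P for P :: "'a measure" +
  fixes F :: "'s::order set" and g :: "'s \<Rightarrow> 'a \<Rightarrow> 's" and s0 :: 's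
  assumes finite_F: "finite F" and s0: "s0 \<in> F"
    and step_measurable: "\<And>s. s \<in> F \<Longrightarrow> g s \<in> P \<rightarrow>\<^sub>M count_space F"
    and step_increasing: "\<And>s c. s \<in> F \<Longrightarrow> c \<in> space P \<Longrightarrow> s \<le> g s c"
begin

lemma state_after_measurable:
  "{1..i} \<subseteq> I \<Longrightarrow> (\<lambda>cs. state_after g s0 cs i) \<in> Pi\<^sub>M I (\<lambda>_. P) \<rightarrow>\<^sub>M count_space F"
proof (induction i)
  case 0
  then show ?case using s0 by simp
next
  case (Suc i)
  have sub: "{1..i} \<subseteq> I" and i: "Suc i \<in> I" using Suc.prems by auto
  note IH = Suc.IH[OF sub]
  have "(\<lambda>cs. g s (cs (Suc i))) \<in> Pi\<^sub>M I (\<lambda>_. P) \<rightarrow>\<^sub>M count_space F" if "s \<in> F" for s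
    by (rule measurable_compose[OF measurable_component_singleton[OF i] step_measurable[OF that]])
  then have "(\<lambda>cs. g (state_after g s0 cs i) (cs (Suc i))) \<in> Pi\<^sub>M I (\<lambda>_. P) \<rightarrow>\<^sub>M count_space F"
    by (rule measurable_compose_countable'[where f = "\<lambda>s cs. g s (cs (Suc i))"
          and g = "\<lambda>cs. state_after g s0 cs i" and I = F])
      (use IH finite_F in \<open>simp_all add: countable_finite\<close>)
  then show ?case by simp
qed

lemma state_after_space:
  "{1..i} \<subseteq> I \<Longrightarrow> cs \<in> space (Pi\<^sub>M I (\<lambda>_. P)) \<Longrightarrow> state_after g s0 cs i \<in> F"
  using measurable_space[OF state_after_measurable] by auto

lemma state_after_measurable_UNIV:
  "{1..i} \<subseteq> I \<Longrightarrow> (\<lambda>cs. state_after g s0 cs i) \<in> Pi\<^sub>M I (\<lambda>_. P) \<rightarrow>\<^sub>M count_space UNIV"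
  by (rule measurable_compose[OF state_after_measurable, where g = "\<lambda>s. s"]) simp_all

lemma step_measurable_UNIV: "s \<in> F \<Longrightarrow> g s \<in> P \<rightarrow>\<^sub>M count_space UNIV"
  by (rule measurable_compose[OF step_measurable, where g = "\<lambda>s. s"]) simp_all

lemma card_hard_rounds_measurable:
  "{1..i} \<subseteq> I \<Longrightarrow> (\<lambda>cs. card (hard_rounds g s0 cs i)) \<in> Pi\<^sub>M I (\<lambda>_. P) \<rightarrow>\<^sub>M count_space UNIV"
proof (induction i)
  case (Suc i)
  then have sub: "{1..i} \<subseteq> I" by auto
  have "{cs \<in> space (Pi\<^sub>M I (\<lambda>_. P)). state_after g s0 cs (Suc i) \<noteq> state_after g s0 cs i} =
     (\<Union>s\<in>F. \<Union>s'\<in>F - {s}. {cs \<in> space (Pi\<^sub>M I (\<lambda>_. P)). state_after g s0 cs (Suc i) = s'} \<inter>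
        {cs \<in> space (Pi\<^sub>M I (\<lambda>_. P)). state_after g s0 cs i = s})"
    using state_after_space[OF sub] state_after_space[OF Suc.prems] by auto
  also have "\<dots> \<in> sets (Pi\<^sub>M I (\<lambda>_. P))"
    using finite_F state_after_measurable_UNIV[OF sub] state_after_measurable_UNIV[OF Suc.prems]
    by (intro sets.finite_UN sets.Int) auto
  finally have [measurable]: "Measurable.pred (Pi\<^sub>M I (\<lambda>_. P)) (\<lambda>cs. state_after g s0 cs (Suc i) \<noteq> state_after g s0 cs i)"
    by (simp add: pred_def)
  have [measurable]: "(\<lambda>cs. card (hard_rounds g s0 cs i)) \<in> Pi\<^sub>M I (\<lambda>_. P) \<rightarrow>\<^sub>M count_space UNIV"
    by (rule Suc.IH[OF sub])
  have "(\<lambda>cs. card (hard_rounds g s0 cs i) + (if state_after g s0 cs (Suc i) \<noteq> state_after g s0 cs i then 1 else 0))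
      \<in> Pi\<^sub>M I (\<lambda>_. P) \<rightarrow>\<^sub>M count_space UNIV"
    by measurable
  then show ?case unfolding card_hard_rounds_Suc of_bool_def .
qed simp

text \<open>Joint measurability of state and number of hard rounds, in the form in which events
  and integrands about them occur.\<close>

lemma outcome_measurable:
  assumes "{1..i} \<subseteq> I" and "\<And>s k. h s k \<in> space N"
  shows "(\<lambda>cs. h (state_after g s0 cs i) (card (hard_rounds g s0 cs i))) \<in> Pi\<^sub>M I (\<lambda>_. P) \<rightarrow>\<^sub>M N"
proof (rule measurable_compose_countable'[where f = "\<lambda>k cs. h (state_after g s0 cs i) k",
        OF _ card_hard_rounds_measurable[OF assms(1)]])
  fix k :: nat
  have "(\<lambda>s. h s k) \<in> count_space UNIV \<rightarrow>\<^sub>M N" using assms(2) by simp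
  then show "(\<lambda>cs. h (state_after g s0 cs i) k) \<in> Pi\<^sub>M I (\<lambda>_. P) \<rightarrow>\<^sub>M N"
    by (rule measurable_compose[OF state_after_measurable_UNIV[OF assms(1)]])
qed auto

text \<open>A supermartingale estimate. For a state in \<open>G\<close> the next round is hard with some
  probability \<open>p \<ge> \<epsilon>\<close> and then costs a factor \<open>exp (-1)\<close>, so in expectation the weight
  shrinks by \<open>1 - p (1 - exp (-1)) \<le> exp (-\<epsilon> (1 - exp (-1)))\<close>. States outside \<open>G\<close> never
  enter \<open>G\<close> because \<open>G\<close> is closed downwards and states grow.\<close>

lemma hard_rounds_exp_moment:
  assumes G_down: "\<And>s s'. s \<le> s' \<Longrightarrow> G s' \<Longrightarrow> G s"
    and G_prob: "\<And>s. s \<in> F \<Longrightarrow> G s \<Longrightarrow> \<epsilon> \<le> prob {c \<in> space P. g s c \<noteq> s}"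
  shows "(\<integral>\<^sup>+cs. ennreal (of_bool (G (state_after g s0 cs n)) * exp (- real (card (hard_rounds g s0 cs n))))
            \<partial>Pi\<^sub>M {1..n} (\<lambda>_. P)) \<le> ennreal (exp (- (real n * \<epsilon> * (1 - exp (- 1)))))"
proof (induction n)
  case 0
  interpret PP: prob_space "Pi\<^sub>M {} (\<lambda>_::nat. P)"
    by (rule prob_space_PiM) (rule prob_space_axioms)
  have "(\<integral>\<^sup>+cs. ennreal (of_bool (G s0)) \<partial>Pi\<^sub>M {} (\<lambda>_::nat. P)) \<le> (\<integral>\<^sup>+cs. 1 \<partial>Pi\<^sub>M {} (\<lambda>_::nat. P))"
    by (rule nn_integral_mono) simp
  then show ?case by (simp add: PP.emeasure_space_1)
next
  case (Suc n)
  let ?Z = "\<lambda>n cs. of_bool (G (state_after g s0 cs n)) * exp (- real (card (hard_rounds g s0 cs n)))"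
  let ?a = "exp (- (\<epsilon> * (1 - exp (- 1))))"
  interpret psf: product_sigma_finite "\<lambda>_::nat. P"
    by (simp add: product_sigma_finite_def sigma_finite_measure_axioms)
  have I: "{1..Suc n} = insert (Suc n) {1..n}" by auto
  have meas: "(\<lambda>cs. ennreal (?Z n cs)) \<in> borel_measurable (Pi\<^sub>M I (\<lambda>_. P))" if "{1..n} \<subseteq> I" for n I
    by (rule outcome_measurable[where
          h = "\<lambda>s k. ennreal (of_bool (G s) * exp (- real k))"]) (use that in auto)
  have step: "(\<integral>\<^sup>+c. ennreal (?Z (Suc n) (cs(Suc n := c))) \<partial>P) \<le> ennreal ?a * ennreal (?Z n cs)"
    if cs: "cs \<in> space (Pi\<^sub>M {1..n} (\<lambda>_. P))" for cs
  proof -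
    define s where "s = state_after g s0 cs n"
    define z where "z = exp (- real (card (hard_rounds g s0 cs n)))"
    have s: "s \<in> F" unfolding s_def by (rule state_after_space[OF order_refl cs])
    have r: "state_after g s0 (cs(Suc n := c)) n = s" and h: "hard_rounds g s0 (cs(Suc n := c)) n = hard_rounds g s0 cs n" for c
      unfolding s_def by (auto intro!: state_after_cong hard_rounds_cong)
    have Z: "?Z (Suc n) (cs(Suc n := c)) = of_bool (G (g s c)) * (z * exp (- of_bool (g s c \<noteq> s)))" for c
      by (subst card_hard_rounds_Suc) (simp add: r h z_def exp_diff exp_minus field_simps)
    let ?E = "{c \<in> space P. g s c \<noteq> s}"
    have E: "?E \<in> sets P" using step_measurable_UNIV[OF s] by simp
    show ?thesis
    proof (cases "G s")
      case True
      have "(LINT c|P. z * (1 - (1 - exp (- 1)) * indicator ?E c))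
          = z * (1 - (1 - exp (- 1)) * prob ?E)"
      proof -
        have "(LINT c|P. 1 - (1 - exp (- 1)) * indicator ?E c)
            = (LINT c|P. 1) - (LINT c|P. (1 - exp (- 1)) * indicat_real ?E c)"
          using E by (intro Bochner_Integration.integral_diff integrable_mult_right integrable_const
              integrable_real_indicator) (auto simp: less_top[symmetric])
        then show ?thesis using E by (simp add: prob_space)
      qed
      also have "\<dots> \<le> z * ?a"
      proof (rule mult_left_mono)
        have "1 - (1 - exp (- 1)) * prob ?E \<le> 1 + (- (\<epsilon> * (1 - exp (- 1::real))))"
          using mult_left_mono[OF G_prob[OF s True], of "1 - exp (- 1)"] by (simp add: mult.commute)
        also have "\<dots> \<le> ?a" by (rule exp_ge_add_one_self)
        finally show "1 - (1 - exp (- 1)) * prob ?E \<le> ?a" .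
      qed (simp add: z_def)
      finally have le: "(LINT c|P. z * (1 - (1 - exp (- 1)) * indicator ?E c)) \<le> z * ?a" .
      have "(\<integral>\<^sup>+c. ennreal (?Z (Suc n) (cs(Suc n := c))) \<partial>P)
         \<le> (\<integral>\<^sup>+c. ennreal (z * (1 - (1 - exp (- 1)) * indicator ?E c)) \<partial>P)"
        unfolding Z by (intro nn_integral_mono ennreal_leI) (auto simp: z_def indicator_def)
      also have "\<dots> = ennreal (LINT c|P. z * (1 - (1 - exp (- 1)) * indicator ?E c))"
        using E by (intro nn_integral_eq_integral integrable_mult_right
            Bochner_Integration.integrable_diff integrable_const integrable_real_indicator AE_I2)
          (auto simp: z_def indicator_def less_top[symmetric])
      also have "\<dots> \<le> ennreal (z * ?a)" using le by (rule ennreal_leI)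
      also have "\<dots> = ennreal ?a * ennreal (?Z n cs)"
        using True by (simp add: z_def s_def ennreal_mult' mult.commute)
      finally show ?thesis .
    next
      case False
      then have "\<not> G (g s c)" if "c \<in> space P" for c
        using G_down step_increasing[OF s that] by blast
      then have "(\<integral>\<^sup>+c. ennreal (?Z (Suc n) (cs(Suc n := c))) \<partial>P) = (\<integral>\<^sup>+c. 0 \<partial>P)"
        unfolding Z by (intro nn_integral_cong) simp
      then show ?thesis by simp
    qed
  qed
  have "(\<integral>\<^sup>+cs. ennreal (?Z (Suc n) cs) \<partial>Pi\<^sub>M {1..Suc n} (\<lambda>_. P)) =
      (\<integral>\<^sup>+cs. (\<integral>\<^sup>+c. ennreal (?Z (Suc n) (cs(Suc n := c))) \<partial>P) \<partial>Pi\<^sub>M {1..n} (\<lambda>_. P))"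
    unfolding I by (rule psf.product_nn_integral_insert)
      (simp, simp, rule meas, simp only: I order_refl)
  also have "\<dots> \<le> (\<integral>\<^sup>+cs. ennreal ?a * ennreal (?Z n cs) \<partial>Pi\<^sub>M {1..n} (\<lambda>_. P))"
    by (intro nn_integral_mono step)
  also have "\<dots> = ennreal ?a * (\<integral>\<^sup>+cs. ennreal (?Z n cs) \<partial>Pi\<^sub>M {1..n} (\<lambda>_. P))"
    by (intro nn_integral_cmult meas) simp
  also have "\<dots> \<le> ennreal ?a * ennreal (exp (- (real n * \<epsilon> * (1 - exp (- 1)))))"
    by (intro mult_left_mono Suc.IH) simp
  also have "\<dots> = ennreal (exp (- (real (Suc n) * \<epsilon> * (1 - exp (- 1)))))"
    by (simp add: ennreal_mult'[symmetric] exp_add[symmetric] algebra_simps)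
  finally show ?case .
qed

text \<open>Markov's inequality for the weight \<open>exp (-|T|)\<close>.\<close>

lemma few_hard_rounds_tail:
  assumes "\<And>s s'. s \<le> s' \<Longrightarrow> G s' \<Longrightarrow> G s"
    and "\<And>s. s \<in> F \<Longrightarrow> G s \<Longrightarrow> \<epsilon> \<le> prob {c \<in> space P. g s c \<noteq> s}"
  shows "measure (Pi\<^sub>M {1..n} (\<lambda>_. P))
      {cs \<in> space (Pi\<^sub>M {1..n} (\<lambda>_. P)). G (state_after g s0 cs n) \<and> card (hard_rounds g s0 cs n) = k}
    \<le> exp (real k - real n * \<epsilon> * (1 - exp (- 1)))"
proof -
  let ?M = "Pi\<^sub>M {1..n} (\<lambda>_. P)"
  let ?A = "{cs \<in> space ?M. G (state_after g s0 cs n) \<and> card (hard_rounds g s0 cs n) = k}"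
  interpret M: prob_space ?M by (rule prob_space_PiM) (rule prob_space_axioms)
  have "Measurable.pred ?M (\<lambda>cs. G (state_after g s0 cs n) \<and> card (hard_rounds g s0 cs n) = k)"
    by (rule outcome_measurable[where h = "\<lambda>s j. G s \<and> j = k"]) auto
  then have A: "?A \<in> sets ?M" by (simp add: pred_def)
  have "emeasure ?M ?A = (\<integral>\<^sup>+cs. indicator ?A cs \<partial>?M)" using A by simp
  also have "\<dots> \<le> (\<integral>\<^sup>+cs. ennreal (exp (real k)) *
      ennreal (of_bool (G (state_after g s0 cs n)) * exp (- real (card (hard_rounds g s0 cs n)))) \<partial>?M)"
    by (intro nn_integral_mono)
      (auto simp: indicator_def ennreal_mult'[symmetric] mult_exp_exp)
  also have "\<dots> = ennreal (exp (real k)) * (\<integral>\<^sup>+cs. 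
      ennreal (of_bool (G (state_after g s0 cs n)) * exp (- real (card (hard_rounds g s0 cs n)))) \<partial>?M)"
    by (intro nn_integral_cmult outcome_measurable[where
          h = "\<lambda>s k. ennreal (of_bool (G s) * exp (- real k))"]) auto
  also have "\<dots> \<le> ennreal (exp (real k)) * ennreal (exp (- (real n * \<epsilon> * (1 - exp (- 1)))))"
    by (rule mult_left_mono, rule hard_rounds_exp_moment, fact assms(1), fact assms(2), simp)
  also have "\<dots> = ennreal (exp (real k - real n * \<epsilon> * (1 - exp (- 1))))"
    by (simp add: ennreal_mult'[symmetric] mult_exp_exp)
  finally show ?thesis
    unfolding M.emeasure_eq_measure by (simp only: ennreal_le_iff exp_ge_zero)
qed

text \<open>In the application \<open>\<rho>\<close> is 0 at a dataset whose loss event is not measurable, so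
  \<open>\<rho>\<close> can fail to be antitone. The bound on \<open>\<rho>\<close> at every later state by the current probability
  of a hard round takes the place of monotonicity: it makes the set of states below some state of
  risk above \<open>\<epsilon>\<close> a suitable \<open>G\<close>.\<close>

lemma hard_rounds_risk_bound:
  fixes \<rho> :: "'s \<Rightarrow> real" and \<delta> :: real
  assumes risk: "\<And>s s'. s \<in> F \<Longrightarrow> s' \<in> F \<Longrightarrow> s \<le> s' \<Longrightarrow> \<rho> s' \<le> prob {c \<in> space P. g s c \<noteq> s}"
    and n: "n \<ge> 1" and \<delta>: "0 < \<delta>" "\<delta> < 1"
  shows "1 - \<delta> \<le> measure (Pi\<^sub>M {1..n} (\<lambda>_. P)) {cs \<in> space (Pi\<^sub>M {1..n} (\<lambda>_. P)).
      \<rho> (state_after g s0 cs n)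
        \<le> 4 / real n * (6 * real (card (hard_rounds g s0 cs n)) + ln (exp 1 / \<delta>))}"
proof -
  let ?M = "Pi\<^sub>M {1..n} (\<lambda>_. P)"
  interpret M: prob_space ?M by (rule prob_space_PiM) (rule prob_space_axioms)
  let ?st = "\<lambda>cs. state_after g s0 cs n" and ?k = "\<lambda>cs. card (hard_rounds g s0 cs n)"
  define \<epsilon> where "\<epsilon> k = 4 / real n * (6 * real k + ln (exp 1 / \<delta>))" for k :: nat
  define G where "G k s \<longleftrightarrow> (\<exists>s'\<in>F. s \<le> s' \<and> \<epsilon> k < \<rho> s')" for k s
  let ?bad = "\<lambda>k. {cs \<in> space ?M. G k (?st cs) \<and> ?k cs = k}"
  let ?good = "{cs \<in> space ?M. \<rho> (?st cs) \<le> \<epsilon> (?k cs)}"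
  have bad_sets: "?bad k \<in> sets ?M" for k
  proof -
    have "Measurable.pred ?M (\<lambda>cs. G k (?st cs) \<and> ?k cs = k)"
      by (rule outcome_measurable[where h = "\<lambda>s j. G k s \<and> j = k"]) auto
    then show ?thesis by (simp add: pred_def)
  qed
  have good_sets: "?good \<in> sets ?M"
  proof -
    have "Measurable.pred ?M (\<lambda>cs. \<rho> (?st cs) \<le> \<epsilon> (?k cs))"
      by (rule outcome_measurable[where h = "\<lambda>s j. \<rho> s \<le> \<epsilon> j"]) auto
    then show ?thesis by (simp add: pred_def)
  qed
  have tail: "M.prob (?bad k) \<le> \<delta> * (1 / 2) ^ Suc k" for k
  proof -
    have "M.prob (?bad k) \<le> exp (real k - real n * \<epsilon> k * (1 - exp (- 1)))"
    proof (rule few_hard_rounds_tail)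
      show "G k s" if "s \<le> s'" "G k s'" for s s'
        using that unfolding G_def by (meson order_trans)
      show "\<epsilon> k \<le> prob {c \<in> space P. g s c \<noteq> s}" if "s \<in> F" "G k s" for s
        using that risk unfolding G_def by (meson less_imp_le order_trans)
    qed
    \<comment> \<open>With \<open>1 - 1/e \<ge> 1/2\<close> the exponent is at most
      \<open>k - 2 (6 k + 1 - ln \<delta>)\<close>, and \<open>ln \<delta> \<le> 0\<close>.\<close>
    also have "\<dots> \<le> exp (ln \<delta> - real (Suc k))"
    proof -
      have n\<epsilon>: "real n * \<epsilon> k = 4 * (6 * real k + 1 - ln \<delta>)"
        using n \<delta> by (simp add: \<epsilon>_def ln_div)
      have "ln \<delta> \<le> 0" using \<delta> by simp
      have "exp (- 1 :: real) \<le> 1 / 2"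
        using exp_ge_add_one_self[of 1] by (simp add: exp_minus field_simps)
      then have "real n * \<epsilon> k * (1 / 2) \<le> real n * \<epsilon> k * (1 - exp (- 1))"
        using \<open>ln \<delta> \<le> 0\<close> by (intro mult_left_mono) (auto simp: n\<epsilon>)
      moreover have "real n * \<epsilon> k * (1 / 2) = 12 * real k + 2 - 2 * ln \<delta>"
        by (simp add: n\<epsilon>)
      ultimately have "real k - real n * \<epsilon> k * (1 - exp (- 1)) \<le> ln \<delta> - real (Suc k)"
        using \<open>ln \<delta> \<le> 0\<close> unfolding of_nat_Suc by linarith
      then show ?thesis by simp
    qed
    also have "\<dots> = \<delta> * exp (- 1) ^ Suc k"
    proof -
      have "exp (- 1 :: real) ^ Suc k = exp (- real (Suc k))"
        by (simp only: exp_of_nat_mult[symmetric] mult_minus_right mult_1_right)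
      then show ?thesis using \<delta> by (simp only: diff_conv_add_uminus exp_add exp_ln)
    qed
    also have "\<dots> \<le> \<delta> * (1 / 2) ^ Suc k"
      using \<delta> exp_ge_add_one_self[of 1]
      by (intro mult_left_mono power_mono) (auto simp: exp_minus field_simps)
    finally show ?thesis .
  qed
  have "space ?M - ?good \<subseteq> (\<Union>k\<in>{..n}. ?bad k)"
  proof
    fix cs assume cs: "cs \<in> space ?M - ?good"
    have "card (hard_rounds g s0 cs n) \<le> card {1..n}"
      by (rule card_mono) (simp, rule hard_rounds_subset)
    moreover have "?st cs \<in> F" using cs by (intro state_after_space) auto
    ultimately show "cs \<in> (\<Union>k\<in>{..n}. ?bad k)"
      using cs by (auto simp: G_def not_le)
  qed
  then have "M.prob (space ?M - ?good) \<le> M.prob (\<Union>k\<in>{..n}. ?bad k)"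
    using bad_sets by (intro M.finite_measure_mono) auto
  also have "\<dots> \<le> (\<Sum>k\<le>n. M.prob (?bad k))"
    using bad_sets by (intro M.finite_measure_subadditive_finite) auto
  also have "\<dots> \<le> (\<Sum>k\<le>n. \<delta> * (1 / 2) ^ Suc k)"
    by (intro sum_mono tail)
  also have "\<dots> = \<delta> * (1 - (1 / 2) ^ Suc n)"
  proof -
    have "(\<Sum>k\<le>n. (1 / 2 :: real) ^ Suc k) = 1 - (1 / 2) ^ Suc n"
      by (induction n) (auto simp: field_simps)
    then show ?thesis by (simp only: sum_distrib_left[symmetric])
  qed
  also have "\<dots> \<le> \<delta>" using \<delta> by (simp add: mult_le_cancel_left1)
  finally have "1 - \<delta> \<le> M.prob ?good"
    using M.prob_compl[OF good_sets] by simp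
  then show ?thesis by (simp only: \<epsilon>_def)
qed

end


section \<open>Removing a null set from completed events\<close>

lemma completion_sets_modulo_null:
  assumes "finite I" "\<And>i. i \<in> I \<Longrightarrow> S i \<in> sets (completion M)"
  obtains N where "N \<in> null_sets M" "\<And>i. i \<in> I \<Longrightarrow> S i - N \<in> sets M"
proof -
  have "\<exists>N. N \<in> null_sets M \<and> null_part M (S i) \<subseteq> N" if "i \<in> I" for i
    using null_part[OF assms(2)[OF that]] .
  then obtain N where N: "\<And>i. i \<in> I \<Longrightarrow> N i \<in> null_sets M"
      "\<And>i. i \<in> I \<Longrightarrow> null_part M (S i) \<subseteq> N i"
    by metis
  have U: "(\<Union>i\<in>I. N i) \<in> null_sets M"
    using N(1) \<open>finite I\<close> by (intro null_sets_UN') (auto intro: countable_finite)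
  moreover have "S i - (\<Union>i\<in>I. N i) \<in> sets M" if "i \<in> I" for i
  proof -
    have "main_part M (S i) \<union> null_part M (S i) = S i" "main_part M (S i) \<in> sets M"
      using assms(2)[OF that] by auto
    moreover from this(1) have "S i - (\<Union>i\<in>I. N i) = main_part M (S i) - (\<Union>i\<in>I. N i)"
      using N(2)[OF that] that by blast
    ultimately show ?thesis using U by auto
  qed
  ultimately show thesis by (rule that)
qed

section \<open>The risk of the cumulative algorithm\<close>

theorem theorem26:
  fixes A :: "real^'d^'m" and b :: "real^'m"
    and C :: "(real^'d) set" and P :: "(real^'d) measure"
    and rule :: "'d rule"
    and n :: nat and \<delta> :: real
  assumes "rank A = CARD('m)"
    and "feasible A b \<noteq> {}" and "bounded (feasible A b)" and "nondegenerate A b"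
    and "convex C"
    and "prob_space P" and "sets P = sets borel" and "AE c in P. c \<in> C"
    and "valid_rule A b C rule"
    and "\<And>D D'. finite D \<Longrightarrow>
           {c \<in> C. pointwise_alg A C rule c D = Some D'} \<in> sets (completion P)"
    and "n \<ge> 1" and "0 < \<delta>" and "\<delta> < 1"
  defines "d_star \<equiv> dim (dir (optimal_vertices (feasible A b) C))"
  shows "\<P>(cs in completion (Pi\<^sub>M {1..n} (\<lambda>_. P)).
           \<exists>D T. cumulative_alg A C rule cs n = Some (D, T) \<and>
             risk P (feasible A b) C D
               \<le> 4 / real n * (6 * real (card T) + ln (exp 1 / \<delta>)) \<and>
             4 / real n * (6 * real (card T) + ln (exp 1 / \<delta>))
               \<le> 4 / real n * (6 * real d_star + ln (exp 1 / \<delta>)))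
         \<ge> 1 - \<delta>"
proof -
  let ?X = "feasible A b" and ?M = "Pi\<^sub>M {1..n} (\<lambda>_. P)"
  let ?alg = "pointwise_alg A C rule"
  define F where "F = query_datasets A b C"
  interpret P: prob_space P by fact
  have space_P: "space P = UNIV"
    using sets_eq_imp_space_eq[OF assms(7)] by simp
  have correct: "\<exists>D'. ?alg c D = Some D' \<and> D \<subseteq> D' \<and> D' \<in> F \<and> pointwise_sufficient ?X C D' c"
    if "c \<in> C" "D \<in> F" for c D
    using pointwise_alg_correct[OF assms(3-5) that(1) assms(9), of D] that(2) by (simp add: F_def)
  have fin_F: "finite F" unfolding F_def by (rule finite_query_datasets)
  have "{c \<in> C. ?alg c (fst p) = Some (snd p)} \<in> sets (completion P)" if "p \<in> F \<times> F" for p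
    using that by (intro assms(10)) (auto simp: F_def query_dataset_finite)
  then obtain N1 where N1: "N1 \<in> null_sets P"
      "\<And>p. p \<in> F \<times> F \<Longrightarrow> {c \<in> C. ?alg c (fst p) = Some (snd p)} - N1 \<in> sets P"
    using fin_F
    by (elim completion_sets_modulo_null[rotated, where I = "F \<times> F"]) auto
  obtain N0 where N0: "{c \<in> space P. c \<notin> C} \<subseteq> N0" "N0 \<in> null_sets P"
    using AE_E[OF assms(8)] by (metis null_setsI)
  define N where "N = N0 \<union> N1"
  have N: "N \<in> null_sets P" using N0 N1 by (auto simp: N_def)
  have C: "c \<in> C" if "c \<notin> N" for c using that N0 by (auto simp: N_def space_P)
  \<comment> \<open>On the null set \<open>N\<close> the state is kept, so \<open>g\<close> is Borel measurable everywhere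
    and follows the algorithm off \<open>N\<close>.\<close>
  define g where "g D c = (if c \<in> N then D else the (?alg c D))" for D c
  have g: "?alg c D = Some (g D c) \<and> D \<subseteq> g D c \<and> g D c \<in> F \<and> pointwise_sufficient ?X C (g D c) c"
    if "c \<notin> N" "D \<in> F" for c D
    using correct[OF C[OF that(1)] that(2)] that by (auto simp: g_def)
  interpret growing_learner P F g "{}"
  proof
    show "finite F" by (rule fin_F)
    show "{} \<in> F" by (simp add: F_def query_datasets_def independent_empty)
    show "s \<le> g s c" if "s \<in> F" "c \<in> space P" for s c
      using g[OF _ that(1), of c] by (cases "c \<in> N") (auto simp: g_def)
    show "g D \<in> P \<rightarrow>\<^sub>M count_space F" if D: "D \<in> F" for D
      unfolding measurable_count_space_eq2[OF fin_F]
    proof (intro conjI ballI)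
      show "g D \<in> space P \<rightarrow> F"
        using g[OF _ D] D by (auto simp: g_def)
      fix D' assume D': "D' \<in> F"
      have "g D -` {D'} \<inter> space P =
          (({c \<in> C. ?alg c D = Some D'} - N1) - N0) \<union> (if D' = D then N else {})"
      proof (rule set_eqI)
        fix c
        show "c \<in> g D -` {D'} \<inter> space P \<longleftrightarrow>
            c \<in> (({c \<in> C. ?alg c D = Some D'} - N1) - N0) \<union> (if D' = D then N else {})"
        proof (cases "c \<in> N")
          case True
          then have "g D c = D" by (simp add: g_def)
          with True show ?thesis by (auto simp: space_P N_def)
        next
          case False
          then have "c \<notin> N0" "c \<notin> N1" by (auto simp: N_def)
          with False show ?thesis using g[OF False D] C[OF False] by (auto simp: space_P)
        qed
      qed
      also have "\<dots> \<in> sets P"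
        using N1(2)[of "(D, D')"] D D' N N0 by auto
      finally show "g D -` {D'} \<inter> space P \<in> sets P" .
    qed
  qed
  interpret cP: prob_space "completion P" by (rule P.prob_space_completion)
  let ?st = "\<lambda>cs. state_after g {} cs" and ?hard = "\<lambda>cs. hard_rounds g {} cs"
  \<comment> \<open>A loss event outside the completion has measure 0 by default, so its risk is 0.
    Otherwise a cost at which the larger \<open>D'\<close> is insufficient changes \<open>D\<close>.\<close>
  have risk: "risk P ?X C D' \<le> P.prob {c \<in> space P. g D c \<noteq> D}"
    if D: "D \<in> F" and D': "D \<le> D'" for D D'
  proof (cases "{c \<in> space P. loss ?X C D' c = 1} \<in> sets (completion P)")
    case True
    have E: "{c \<in> space P. g D c \<noteq> D} \<in> sets P"
      using step_measurable_UNIV[OF D] by simp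
    have "AE c in P. c \<notin> N" using N by (rule AE_not_in)
    moreover have "loss ?X C D' c = 1 \<longrightarrow> g D c \<noteq> D" if "c \<notin> N" for c
      using g[OF that D] pointwise_sufficient_mono[OF D'] by (auto simp: loss_def)
    ultimately have "AE c in P. loss ?X C D' c = 1 \<longrightarrow> g D c \<noteq> D"
      by (auto elim: eventually_mono)
    then have "AE c in completion P. c \<in> {c \<in> space P. loss ?X C D' c = 1}
        \<longrightarrow> c \<in> {c \<in> space P. g D c \<noteq> D}"
      by (intro AE_completion) (auto elim: eventually_mono simp: space_P)
    then have "cP.prob {c \<in> space P. loss ?X C D' c = 1} \<le> cP.prob {c \<in> space P. g D c \<noteq> D}"
      by (rule cP.finite_measure_mono_AE) (use E in auto)
    then show ?thesis using E by (simp add: risk_def)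
  next
    case False
    then show ?thesis by (simp add: risk_def measure_notin_sets)
  qed
  let ?good = "{cs \<in> space ?M. risk P ?X C (?st cs n)
      \<le> 4 / real n * (6 * real (card (?hard cs n)) + ln (exp 1 / \<delta>))}"
  let ?ev = "\<lambda>cs. \<exists>D T. cumulative_alg A C rule cs n = Some (D, T) \<and>
      risk P ?X C D \<le> 4 / real n * (6 * real (card T) + ln (exp 1 / \<delta>)) \<and>
      4 / real n * (6 * real (card T) + ln (exp 1 / \<delta>))
        \<le> 4 / real n * (6 * real d_star + ln (exp 1 / \<delta>))"
  have good: "1 - \<delta> \<le> measure ?M ?good"
    by (rule hard_rounds_risk_bound) (use risk assms(11-13) in auto)
  have good_sets: "?good \<in> sets ?M"
  proof -
    have "Measurable.pred ?M (\<lambda>cs. risk P ?X C (?st cs n)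
        \<le> 4 / real n * (6 * real (card (?hard cs n)) + ln (exp 1 / \<delta>)))"
      by (rule outcome_measurable[where h = "\<lambda>s k. risk P ?X C s
            \<le> 4 / real n * (6 * real k + ln (exp 1 / \<delta>))"]) auto
    then show ?thesis by (simp add: pred_def)
  qed
  \<comment> \<open>Every hard round enlarges the dataset, hence \<open>|T| \<le> |D\<^sub>n| \<le> d\<^sup>\<star>\<close>.\<close>
  have sim: "cumulative_alg A C rule cs i = Some (?st cs i, ?hard cs i) \<and> ?st cs i \<in> F
      \<and> card (?hard cs i) \<le> card (?st cs i)"
    if "\<forall>j\<in>{1..n}. cs j \<notin> N" "i \<le> n" for cs i
    using that(2)
  proof (induction i)
    case 0
    then show ?case using s0 by simp
  next
    case (Suc i)
    let ?s = "?st cs i" and ?s' = "?st cs (Suc i)"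
    have IH: "cumulative_alg A C rule cs i = Some (?s, ?hard cs i)" "?s \<in> F"
      "card (?hard cs i) \<le> card ?s"
      using Suc by auto
    have "cs (Suc i) \<notin> N" using that(1) Suc.prems by auto
    from g[OF this IH(2)] have s': "?alg (cs (Suc i)) ?s = Some ?s'" "?s \<subseteq> ?s'" "?s' \<in> F"
      by auto
    have "card (?hard cs (Suc i)) \<le> card ?s'"
    proof (cases "?s' = ?s")
      case False
      then have "card ?s < card ?s'"
        using s' by (intro psubset_card_mono) (auto simp: F_def query_dataset_finite)
      then show ?thesis using IH(3) False card_hard_rounds_Suc[of g "{}" cs i] by simp
    next
      case True
      then show ?thesis using IH(3) card_hard_rounds_Suc[of g "{}" cs i] by simp
    qed
    moreover have "cumulative_alg A C rule cs (Suc i) = Some (?s', ?hard cs (Suc i))"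
      using IH(1) s'(1) by simp
    ultimately show ?case using s'(3) by blast
  qed
  have "AE cs in ?M. \<forall>j\<in>{1..n}. cs j \<notin> N"
    using N by (intro AE_finite_allI AE_PiM_component) (auto intro: AE_not_in P.prob_space_axioms)
  then have "AE cs in ?M. cs \<in> ?good \<longleftrightarrow> cs \<in> {cs \<in> space ?M. ?ev cs}"
  proof (rule AE_mp, intro AE_I2 impI)
    fix cs assume cs: "cs \<in> space ?M" "\<forall>j\<in>{1..n}. cs j \<notin> N"
    have alg: "cumulative_alg A C rule cs n = Some (?st cs n, ?hard cs n)"
      and "card (?hard cs n) \<le> d_star"
      using sim[OF cs(2), of n] query_dataset_card[of "?st cs n" A b C]
      by (auto simp: F_def d_star_def)
    then have "4 / real n * (6 * real (card (?hard cs n)) + ln (exp 1 / \<delta>))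
        \<le> 4 / real n * (6 * real d_star + ln (exp 1 / \<delta>))"
      by (intro mult_left_mono add_right_mono) simp_all
    then show "cs \<in> ?good \<longleftrightarrow> cs \<in> {cs \<in> space ?M. ?ev cs}"
      using cs(1) unfolding mem_Collect_eq alg option.inject prod.inject by blast
  qed
  then have ae: "AE cs in completion ?M. cs \<in> ?good \<longleftrightarrow> cs \<in> {cs \<in> space ?M. ?ev cs}"
    by (rule AE_completion)
  then have ev_sets: "{cs \<in> space ?M. ?ev cs} \<in> sets (completion ?M)"
    by (rule completion.in_sets_AE) (use good_sets in auto)
  have "measure ?M ?good = measure (completion ?M) ?good"
    using good_sets by simp
  also have "\<dots> = measure (completion ?M) {cs \<in> space ?M. ?ev cs}"
    using ae ev_sets good_sets by (intro measure_eq_AE) auto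
  finally show ?thesis using good by (simp only: space_completion)
qed

end
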